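(* Let $k\geq 1$ be an integer. Let $P$ be a magic square of subtraction of order $4$, let $J$ be the $4\times 4$ matrix with all entries equal to $1$, and let $Q$ be the $k\times k$ block matrix whose $(i,j)$ block ($1\le i,j\le k$) is the $4\times 4$ matrix $$Q_{i,j}=P+16\left(k(i-1)+j-1\right)J .$$ Then $Q$, regarded as a $4k\times 4k$ matrix, is a magic square of subtraction of order $4k$.
   Context: For a vector $\mathbf{x}=(x_1,\ldots,x_n)$, let $\tilde{x}_1\geq\tilde{x}_2\geq\cdots\geq\tilde{x}_n$ be its entries sorted in decreasing order. The residuum of $\mathbf{x}$ is $\mathrm{res}(\mathbf{x})=\sum_{i=1}^n(-1)^{i+1}\tilde{x}_i=\tilde{x}_1-\tilde{x}_2+\tilde{x}_3-\cdots$. A magic square of subtraction of order $n$ (always understood to be normal) is an $n\times n$ array in which each of the integers $1,2,\ldots,n^2$ appears exactly once and such that all rows, all columns, and both diagonals (the main diagonal and the antidiagonal) have the same residuum. *)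

theory Defs
  imports "Jordan_Normal_Form.Matrix"
begin

text \<open>Indices are 0-based, so the sign of the \<open>i\<close>-th largest entry is \<open>(- 1) ^ i\<close>.\<close>

definition residuum :: "'a :: linordered_idom vec \<Rightarrow> 'a" where
  "residuum x = (\<Sum>i<dim_vec x. (- 1) ^ i * rev (sort (list_of_vec x)) ! i)"

definition main_diag :: "'a mat \<Rightarrow> 'a vec" where
  "main_diag A = vec (dim_row A) (\<lambda>i. A $$ (i, i))"

definition anti_diag :: "'a mat \<Rightarrow> 'a vec" where
  "anti_diag A = vec (dim_row A) (\<lambda>i. A $$ (i, dim_row A - 1 - i))"

definition magic_square_of_subtraction :: "nat \<Rightarrow> int mat \<Rightarrow> bool" where
  "magic_square_of_subtraction n A \<longleftrightarrow>
     A \<in> carrier_mat n n \<and>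
     bij_betw (\<lambda>ij. A $$ ij) ({..<n} \<times> {..<n}) {1..(int n)\<^sup>2} \<and>
     (\<exists>r. (\<forall>i<n. residuum (row A i) = r) \<and>
          (\<forall>j<n. residuum (col A j) = r) \<and>
          residuum (main_diag A) = r \<and>
          residuum (anti_diag A) = r)"

definition all_ones_mat :: "nat \<Rightarrow> int mat" where
  "all_ones_mat n = mat n n (\<lambda>_. 1)"

text \<open>The \<open>k \<times> k\<close> block matrix with \<open>m \<times> m\<close> blocks \<open>B i j\<close>, where the block indices
  \<open>i\<close> and \<open>j\<close> run from 1 to \<open>k\<close>, unlike the 0-based entry indices.\<close>

definition block_mat :: "nat \<Rightarrow> nat \<Rightarrow> (nat \<Rightarrow> nat \<Rightarrow> 'a mat) \<Rightarrow> 'a mat" where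
  "block_mat k m B = mat (m * k) (m * k)
     (\<lambda>(r, c). B (r div m + 1) (c div m + 1) $$ (r mod m, c mod m))"

end

theory Submission
  imports Defs
begin

text \<open>Every row, column and diagonal of \<open>Q\<close> is a concatenation of shifted copies of one line of
  \<open>P\<close>. The entries of \<open>P\<close> lie in \<open>{1..16}\<close> and the shifts are increasing multiples of \<open>16\<close>, so
  sorting keeps the copies separate. Since each copy has even length, a shift does not change
  its residuum, and the alternating signs restart with \<open>+\<close> at each copy. Hence the residuum of
  every line of \<open>Q\<close> is \<open>k\<close> times that of the lines of \<open>P\<close>.\<close>

section \<open>Alternating sums, shifts and sorting of lists\<close>

text \<open>The part of \<open>residuum\<close> that remains once sorting is removed. Lists replace
  vectors so that concatenation and shifts can be handled apart from the sort.\<close>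

definition alt_sum :: "'a :: linordered_idom list \<Rightarrow> 'a" where
  "alt_sum xs = (\<Sum>i<length xs. (- 1) ^ i * xs ! i)"

lemma residuum_vec: "residuum (vec n f) = alt_sum (rev (sort (map f [0..<n])))"
proof -
  have "list_of_vec (vec n f) = map f [0..<n]"
    by (intro nth_equalityI) auto
  then show ?thesis
    by (simp add: residuum_def alt_sum_def)
qed

lemma alt_sum_append:
  assumes "even (length xs)"
  shows "alt_sum (xs @ ys) = alt_sum xs + alt_sum ys"
proof -
  have split: "(\<Sum>i<m + n. g i) = (\<Sum>i<m. g i) + (\<Sum>i<n. g (m + i))"
    for m n and g :: "nat \<Rightarrow> 'a"
    by (induction n) (simp_all add: add.assoc)
  have "alt_sum (xs @ ys) = (\<Sum>i<length xs + length ys. (- 1) ^ i * (xs @ ys) ! i)"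
    by (simp add: alt_sum_def)
  also have "\<dots> = (\<Sum>i<length xs. (- 1) ^ i * (xs @ ys) ! i) +
      (\<Sum>i<length ys. (- 1) ^ (length xs + i) * (xs @ ys) ! (length xs + i))"
    by (rule split)
  also have "\<dots> = alt_sum xs + alt_sum ys"
    using assms by (simp add: alt_sum_def power_add nth_append)
  finally show ?thesis .
qed

text \<open>The added \<open>c\<close> enters with alternating signs, and these contributions cancel
  in consecutive pairs.\<close>

lemma alt_sum_map_add:
  assumes "even (length xs)"
  shows "alt_sum (map (\<lambda>x. x + c) xs) = alt_sum xs"
proof -
  have "(\<Sum>i<n. (- 1) ^ i * c) = 0" if "even n" for n
  proof -
    have "(\<Sum>i<2 * l. (- 1) ^ i * c) = 0" for l
      by (induction l) simp_all
    with that show ?thesis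
      by blast
  qed
  with assms show ?thesis
    by (simp add: alt_sum_def distrib_left sum.distrib)
qed

lemma sort_append_separated:
  assumes "\<And>x y. x \<in> set xs \<Longrightarrow> y \<in> set ys \<Longrightarrow> x \<le> y"
  shows "sort (xs @ ys) = sort xs @ sort ys"
  using assms by (intro properties_for_sort) (auto simp: sorted_append)

lemma sort_map_add:
  fixes c :: "'a :: linordered_idom"
  shows "sort (map (\<lambda>x. x + c) xs) = map (\<lambda>x. x + c) (sort xs)"
  by (intro properties_for_sort)
    (auto simp: sorted_wrt_map intro: sorted_wrt_mono_rel[OF _ sorted_sort])

text \<open>Induction on \<open>k\<close>: the last copy lies above all earlier ones, so in
  decreasing order it comes first and contributes one more \<open>residuum (vec m x)\<close>. The
  multiplier \<open>f\<close> is kept abstract because each kind of line of the block matrix has its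
  own.\<close>

lemma residuum_shifted_copies:
  fixes x :: "nat \<Rightarrow> int" and f :: "nat \<Rightarrow> int"
  assumes m: "even m"
    and x: "\<And>a. a < m \<Longrightarrow> x a \<in> {1..N}"
    and f: "\<And>b c. b < c \<Longrightarrow> c < k \<Longrightarrow> f b < f c"
  shows "residuum (vec (m * k) (\<lambda>i. x (i mod m) + N * f (i div m))) = int k * residuum (vec m x)"
  using f
proof (induction k)
  case 0
  show ?case
    by (simp add: residuum_vec alt_sum_def)
next
  case (Suc k)
  show ?case
  proof (cases "m = 0")
    case True
    then show ?thesis
      by (simp add: residuum_vec alt_sum_def)
  next
    case False
    define h where "h = (\<lambda>i. x (i mod m) + N * f (i div m))"
    let ?old = "map h [0..<m * k]" and ?new = "map h [m * k..<m * k + m]"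
    have new: "?new = map (\<lambda>y. y + N * f k) (map x [0..<m])"
      using False by (intro nth_equalityI) (simp_all add: h_def)
    have "y \<le> z" if y: "y \<in> set ?old" and z: "z \<in> set ?new" for y z
    proof -
      obtain i where i: "i < m * k" "y = h i"
        using y by auto
      obtain a where a: "a < m" "z = x a + N * f k"
        using z unfolding new by auto
      have xi: "x (i mod m) \<in> {1..N}"
        using False by (intro x) simp
      have "i div m < k"
        using i by (simp add: less_mult_imp_div_less mult.commute)
      \<comment> \<open>Integrality turns the strict growth of \<open>f\<close> into a gap of at
        least one, hence of at least \<open>N\<close> between the shifts. This absorbs the spread of
        \<open>x\<close> over \<open>{1..N}\<close>.\<close>
      then have "f (i div m) + 1 \<le> f k"
        using Suc.prems by (simp add: add1_zle_eq)
      \<comment> \<open>The element \<open>x (i mod m)\<close> of \<open>{1..N}\<close> shows that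
        \<open>N\<close> is positive, so multiplying by it preserves the order.\<close>
      then have "N * (f (i div m) + 1) \<le> N * f k"
        using xi by (intro mult_left_mono) auto
      then show ?thesis
        using xi x[OF a(1)] i a by (simp add: h_def algebra_simps)
    qed
    then have "sort (?old @ ?new) = sort ?old @ sort ?new"
      by (rule sort_append_separated)
    then have "alt_sum (rev (sort (?old @ ?new))) =
        alt_sum (rev (sort ?new)) + alt_sum (rev (sort ?old))"
      using m by (simp add: alt_sum_append)
    also have "alt_sum (rev (sort ?new)) = residuum (vec m x)"
      unfolding new sort_map_add rev_map residuum_vec
      using m by (intro alt_sum_map_add) simp
    also have "alt_sum (rev (sort ?old)) = int k * residuum (vec m x)"
      using Suc unfolding h_def residuum_vec by simp
    also have "?old @ ?new = map h [0..<m * Suc k]"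
      by (metis add.commute le_add1 map_append mult_Suc_right upt_add_eq_append zero_le)
    finally show ?thesis
      unfolding residuum_vec h_def by (simp add: distrib_right)
  qed
qed

text \<open>After subtracting 1, a value is decoded by division by \<open>(int m)\<^sup>2\<close>:
  the quotient is the number of the block and the remainder determines the position inside it. This
  gives injectivity; surjectivity follows by counting, since the image lies in a finite set of the
  same cardinality.\<close>

lemma bij_betw_blocks:
  fixes p :: "nat \<times> nat \<Rightarrow> int"
  assumes p: "bij_betw p ({..<m} \<times> {..<m}) {1..(int m)\<^sup>2}"
  shows "bij_betw
    (\<lambda>(r, c). p (r mod m, c mod m) + (int m)\<^sup>2 * (int k * int (r div m) + int (c div m)))
    ({..<m * k} \<times> {..<m * k}) {1..(int (m * k))\<^sup>2}"
    (is "bij_betw ?q ?A ?B")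
proof (cases "m = 0")
  case True
  then show ?thesis
    by (simp add: bij_betw_def)
next
  case False
  have p_range: "p (r mod m, c mod m) \<in> {1..(int m)\<^sup>2}" for r c
    using p False by (auto simp: bij_betw_def)
  have bound: "i div m < k" if "i < m * k" for i
    using that by (simp add: less_mult_imp_div_less mult.commute)
  have quot: "(?q (r, c) - 1) div (int m)\<^sup>2 = int (k * (r div m) + c div m)"
    and rem: "(?q (r, c) - 1) mod (int m)\<^sup>2 = p (r mod m, c mod m) - 1" for r c
  proof -
    let ?t = "p (r mod m, c mod m) - 1" and ?s = "int k * int (r div m) + int (c div m)"
    have t: "0 \<le> ?t" "?t < (int m)\<^sup>2"
      using p_range[of r c] by auto
    have eq: "?q (r, c) - 1 = ?t + (int m)\<^sup>2 * ?s"
      by simp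
    show "(?q (r, c) - 1) div (int m)\<^sup>2 = int (k * (r div m) + c div m)"
      unfolding eq using t False by (simp add: div_pos_pos_trivial)
    show "(?q (r, c) - 1) mod (int m)\<^sup>2 = ?t"
      unfolding eq using t by (simp add: mod_pos_pos_trivial)
  qed
  have "(r, c) = (r', c')"
    if lt: "r < m * k" "c < m * k" "r' < m * k" "c' < m * k"
      and eq: "?q (r, c) = ?q (r', c')" for r c r' c'
  proof -
    from quot[of r c] quot[of r' c'] eq
    have "k * (r div m) + c div m = k * (r' div m) + c' div m"
      by (metis of_nat_eq_iff)
    \<comment> \<open>Because \<open>c div m < k\<close>, the block number is a two-digit number in
      base \<open>k\<close>, and its digits are the block coordinates.\<close>
    from arg_cong[OF this, of "\<lambda>n. n div k"] arg_cong[OF this, of "\<lambda>n. n mod k"]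
    have d: "r div m = r' div m" "c div m = c' div m"
      using lt[THEN bound] by auto
    from rem[of r c] rem[of r' c'] eq
    have "p (r mod m, c mod m) = p (r' mod m, c' mod m)"
      by (metis diff_add_cancel)
    then have "(r mod m, c mod m) = (r' mod m, c' mod m)"
      using p False by (auto simp: bij_betw_def dest: inj_onD)
    with d show ?thesis
      by (metis Pair_inject div_mult_mod_eq)
  qed
  then have inj: "inj_on ?q ?A"
    unfolding inj_on_def by fast
  have "?q (r, c) \<in> ?B" if "r < m * k" "c < m * k" for r c
  proof -
    let ?s = "int k * int (r div m) + int (c div m)"
    have r: "int (r div m) + 1 \<le> int k" and c: "int (c div m) + 1 \<le> int k"
      using bound that by fastforce+
    \<comment> \<open>Block numbers are at most \<open>k * k - 1\<close>, so the values of the last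
      block end at \<open>(int (m * k))\<^sup>2\<close>.\<close>
    have "?s + 1 \<le> int k * int (r div m) + int k"
      using c by simp
    also have "\<dots> = int k * (int (r div m) + 1)"
      by (simp add: algebra_simps)
    also have "\<dots> \<le> int k * int k"
      using r by (intro mult_left_mono) auto
    finally have "(int m)\<^sup>2 * (?s + 1) \<le> (int m)\<^sup>2 * (int k * int k)"
      by (intro mult_left_mono) auto
    then have "(int m)\<^sup>2 * ?s + (int m)\<^sup>2 \<le> (int (m * k))\<^sup>2"
      by (simp add: algebra_simps power2_eq_square)
    moreover have "0 \<le> (int m)\<^sup>2 * ?s"
      by simp
    ultimately show ?thesis
      using p_range[of r c] unfolding prod.case atLeastAtMost_iff by linarith
  qed
  then have "?q ` ?A \<subseteq> ?B"
    by fast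
  moreover have "card (?q ` ?A) = card ?B"
    unfolding card_image[OF inj] by (simp add: power2_eq_square nat_mult_distrib)
  ultimately have "?q ` ?A = ?B"
    by (intro card_subset_eq) auto
  with inj show ?thesis
    by (simp add: bij_betw_def)
qed

section \<open>The block construction for even orders\<close>

text \<open>From one block to the next, the multiplier of \<open>(int m)\<^sup>2\<close> grows by 1
  along a row, \<open>k\<close> down a column, \<open>k + 1\<close> on the main diagonal and
  \<open>k - 1\<close> on the antidiagonal. Each line is thus a case of
  \<open>residuum_shifted_copies\<close>.\<close>

lemma magic_square_of_subtraction_block_mat:
  fixes P :: "int mat"
  assumes m: "even m" "m > 0"
    and P: "magic_square_of_subtraction m P"
  shows "magic_square_of_subtraction (m * k) (block_mat k m
    (\<lambda>i j. P + ((int m)\<^sup>2 * (int k * (int i - 1) + int j - 1)) \<cdot>\<^sub>m all_ones_mat m))"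
    (is "magic_square_of_subtraction _ ?Q")
proof -
  from P have dim: "P \<in> carrier_mat m m"
    and bij: "bij_betw (\<lambda>ij. P $$ ij) ({..<m} \<times> {..<m}) {1..(int m)\<^sup>2}"
    by (simp_all add: magic_square_of_subtraction_def)
  from P obtain s where row: "\<And>i. i < m \<Longrightarrow> residuum (row P i) = s"
    and col: "\<And>j. j < m \<Longrightarrow> residuum (col P j) = s"
    and diag: "residuum (main_diag P) = s" "residuum (anti_diag P) = s"
    by (auto simp: magic_square_of_subtraction_def)
  have P_range: "1 \<le> P $$ (i, j)" "P $$ (i, j) \<le> (int m)\<^sup>2" if "i < m" "j < m" for i j
    using bij that by (force simp: bij_betw_def)+
  have Q_dim: "?Q \<in> carrier_mat (m * k) (m * k)"
    by (simp add: block_mat_def)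
  \<comment> \<open>The \<open>+ 1\<close> on each block index in \<open>block_mat\<close> cancels
    the matching \<open>- 1\<close> in the shift.\<close>
  have Q: "?Q $$ (r, c) =
      P $$ (r mod m, c mod m) + (int m)\<^sup>2 * (int k * int (r div m) + int (c div m))"
    if "r < m * k" "c < m * k" for r c
    using that m dim by (simp add: block_mat_def all_ones_mat_def)
  have k_pos: "k > 0" if "i < m * k" for i
    using that by (cases k) auto
  have "residuum (row ?Q i) = int k * s" if i: "i < m * k" for i
  proof -
    let ?f = "\<lambda>b. int k * int (i div m) + int b"
    have "row ?Q i = vec (m * k) (\<lambda>j. P $$ (i mod m, j mod m) + (int m)\<^sup>2 * ?f (j div m))"
      using i Q_dim by (intro eq_vecI) (auto simp: Q)
    then have "residuum (row ?Q i) = int k * residuum (vec m (\<lambda>j. P $$ (i mod m, j)))"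
      using m by (simp only:) (rule residuum_shifted_copies, auto intro!: P_range)
    also have "vec m (\<lambda>j. P $$ (i mod m, j)) = row P (i mod m)"
      using dim m by (intro eq_vecI) auto
    finally show ?thesis
      using m by (simp add: row)
  qed
  moreover have "residuum (col ?Q j) = int k * s" if j: "j < m * k" for j
  proof -
    \<comment> \<open>Strict growth of \<open>?f\<close> needs \<open>k > 0\<close>, which the
      existence of the column index \<open>j\<close> provides.\<close>
    let ?f = "\<lambda>b. int k * int b + int (j div m)"
    have "col ?Q j = vec (m * k) (\<lambda>i. P $$ (i mod m, j mod m) + (int m)\<^sup>2 * ?f (i div m))"
      using j Q_dim by (intro eq_vecI) (auto simp: Q)
    then have "residuum (col ?Q j) = int k * residuum (vec m (\<lambda>i. P $$ (i, j mod m)))"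
      using m k_pos[OF j] by (simp only:) (rule residuum_shifted_copies, auto intro!: P_range)
    also have "vec m (\<lambda>i. P $$ (i, j mod m)) = col P (j mod m)"
      using dim m by (intro eq_vecI) auto
    finally show ?thesis
      using m by (simp add: col)
  qed
  moreover have "residuum (main_diag ?Q) = int k * s"
  proof -
    let ?f = "\<lambda>b. int k * int b + int b"
    have "main_diag ?Q =
        vec (m * k) (\<lambda>i. P $$ (i mod m, i mod m) + (int m)\<^sup>2 * ?f (i div m))"
      using Q_dim by (intro eq_vecI) (auto simp: Q main_diag_def)
    then have "residuum (main_diag ?Q) = int k * residuum (vec m (\<lambda>i. P $$ (i, i)))"
      using m by (simp only:) (rule residuum_shifted_copies,
        auto intro!: P_range add_le_less_mono mult_left_mono)
    also have "vec m (\<lambda>i. P $$ (i, i)) = main_diag P"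
      using dim by (simp add: main_diag_def)
    finally show ?thesis
      by (simp add: diag)
  qed
  moreover have "residuum (anti_diag ?Q) = int k * s"
  proof -
    let ?f = "\<lambda>b. int k * int b + int (k - 1 - b)"
    have "anti_diag ?Q =
        vec (m * k) (\<lambda>i. P $$ (i mod m, m - 1 - i mod m) + (int m)\<^sup>2 * ?f (i div m))"
    proof (intro eq_vecI, goal_cases)
      case (1 i)
      then have i: "i < m * k"
        by simp
      let ?b = "i div m" and ?a = "i mod m"
      have b: "?b < k" and a: "?a < m"
        using i m by (simp_all add: less_mult_imp_div_less mult.commute)
      \<comment> \<open>Reversing the index complements both digits: the quotient by
        \<open>m\<close> becomes \<open>k - 1 - ?b\<close> and the remainder
        \<open>m - 1 - ?a\<close>.\<close>
      have "m * k = m * (k - 1 - ?b) + m * ?b + m"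
        using b by (metis Suc_diff_Suc add.commute add_mult_distrib2 diff_Suc_1 diff_diff_left
          le_add_diff_inverse less_imp_le mult_Suc_right plus_1_eq_Suc group_cancel.add1)
      moreover have "i = m * ?b + ?a"
        by simp
      ultimately have c: "m * k - 1 - i = m * (k - 1 - ?b) + (m - 1 - ?a)"
        using a by linarith
      have "(m * k - 1 - i) mod m = m - 1 - ?a" "(m * k - 1 - i) div m = k - 1 - ?b"
        unfolding c using m by simp_all
      then show ?case
        using i Q_dim by (simp add: anti_diag_def Q)
    qed (use Q_dim in \<open>simp add: anti_diag_def\<close>)
    \<comment> \<open>The block columns run backwards, which leaves the slope \<open>k - 1\<close>.
      It is positive because two distinct block indices below \<open>k\<close> force
      \<open>k\<close> to be at least 2.\<close>
    moreover have "?f b < ?f c" if bc: "b < c" "c < k" for b c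
    proof -
      have "int (k - 1 - b) = int k - 1 - int b" "int (k - 1 - c) = int k - 1 - int c"
        using bc by auto
      moreover have "(int k - 1) * int b < (int k - 1) * int c"
        using bc by (intro mult_strict_left_mono) auto
      ultimately show ?thesis
        by (simp add: algebra_simps)
    qed
    ultimately have "residuum (anti_diag ?Q) =
        int k * residuum (vec m (\<lambda>i. P $$ (i, m - 1 - i)))"
      using m by (simp only:) (rule residuum_shifted_copies, auto intro!: P_range)
    also have "vec m (\<lambda>i. P $$ (i, m - 1 - i)) = anti_diag P"
      using dim by (simp add: anti_diag_def)
    finally show ?thesis
      by (simp add: diag)
  qed
  moreover have "bij_betw (\<lambda>ij. ?Q $$ ij) ({..<m * k} \<times> {..<m * k}) {1..(int (m * k))\<^sup>2}"
    using bij_betw_blocks[OF bij, of k]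
    by (rule bij_betw_cong[THEN iffD1, rotated]) (auto simp: Q)
  ultimately show ?thesis
    using Q_dim unfolding magic_square_of_subtraction_def by blast
qed

theorem proposition2:
  fixes k :: nat and P Q :: "int mat"
  assumes "k \<ge> 1"
    and "magic_square_of_subtraction 4 P"
    and "Q = block_mat k 4
           (\<lambda>i j. P + (16 * (int k * (int i - 1) + int j - 1)) \<cdot>\<^sub>m all_ones_mat 4)"
  shows "magic_square_of_subtraction (4 * k) Q"
  \<comment> \<open>For \<open>m = 4\<close> the factor \<open>(int m)\<^sup>2\<close> is the
    constant \<open>16\<close>.\<close>
  using magic_square_of_subtraction_block_mat[OF _ _ assms(2), of k] assms(3) by simp

end
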